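(* Let $V$ be a finite set and let $\{(K_t,\pi_t)\}_{t\ge1}$ be a finite non-decreasing environment on $V$. For each $t\ge1$ let $\tilde\pi_t=\pi_t/\pi_t(V)$. Then for all $x,y\in V$ the sequence $$\left(\frac{1}{\pi_t(V)}\,s_\infty(\mu_t^x,\mu_t^y\mid\tilde\pi_t)\right)_{t\ge1}$$ is non-increasing.
   Context: A Markov transition operator $K$ on $V$ is a map $K:V\times V\to[0,1]$ with $\sum_y K(x,y)=1$ for all $x$; it acts on measures by $(\mu K)(y)=\sum_x\mu(x)K(x,y)$. Finite non-decreasing environment: $(K_t)_{t\ge1}$ are Markov transition operators and $(\pi_t)_{t\ge1}$ positive measures ($\pi_t(x)>0$ for all $x$) with, for all $t\ge1$: $\pi_tK_t=\pi_t$; $\pi_t(V)<+\infty$; $\pi_{t+1}(x)\ge\pi_t(x)$ for all $x\in V$. $\mu_t^x=\delta_xK_1K_2\cdots K_t$ is the law at time $t$ of the chain started at $x$ and driven by $(K_t)_{t\ge1}$. For a probability $\tilde\pi$ with $\tilde\pi(z)>0$ for all $z$, $s_\infty(\mu,\nu\mid\tilde\pi)=\max_{z\in V}\left|\frac{\mu(z)-\nu(z)}{\tilde\pi(z)}\right|$. *)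

theory Defs
  imports "HOL-Analysis.Analysis"
begin

text \<open>Measures on the state space \<open>V\<close> are given by their point masses, and only their values on
  \<open>V\<close> matter. The sums over \<open>V\<close> are unordered infinite sums, so that finite environments
  make sense on an arbitrary \<open>V\<close>; if \<open>V\<close> is finite, they are ordinary finite sums.\<close>

definition markov_operator :: "'a set \<Rightarrow> ('a \<Rightarrow> 'a \<Rightarrow> real) \<Rightarrow> bool" where
  "markov_operator V K \<longleftrightarrow>
     (\<forall>x\<in>V. \<forall>y\<in>V. K x y \<in> {0..1}) \<and> (\<forall>x\<in>V. (K x has_sum 1) V)"

definition act :: "'a set \<Rightarrow> ('a \<Rightarrow> real) \<Rightarrow> ('a \<Rightarrow> 'a \<Rightarrow> real) \<Rightarrow> 'a \<Rightarrow> real" where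
  "act V \<mu> K y = (\<Sum>\<^sub>\<infinity>x\<in>V. \<mu> x * K x y)"

definition mass :: "'a set \<Rightarrow> ('a \<Rightarrow> real) \<Rightarrow> real" where
  "mass V \<mu> = (\<Sum>\<^sub>\<infinity>x\<in>V. \<mu> x)"

definition normalized :: "'a set \<Rightarrow> ('a \<Rightarrow> real) \<Rightarrow> 'a \<Rightarrow> real" where
  "normalized V \<mu> z = \<mu> z / mass V \<mu>"

text \<open>The condition \<open>\<pi> t summable_on V\<close> says that the total mass is finite. The index
  \<open>t\<close> starts at \<open>1\<close>: the values \<open>K 0\<close> and \<open>\<pi> 0\<close> are unconstrained and never used.\<close>

definition finite_nondecreasing_environment ::
  "'a set \<Rightarrow> (nat \<Rightarrow> 'a \<Rightarrow> 'a \<Rightarrow> real) \<Rightarrow> (nat \<Rightarrow> 'a \<Rightarrow> real) \<Rightarrow> bool" where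
  "finite_nondecreasing_environment V K \<pi> \<longleftrightarrow>
     (\<forall>t\<ge>1. markov_operator V (K t) \<and>
            (\<forall>x\<in>V. \<pi> t x > 0) \<and>
            (\<forall>y\<in>V. act V (\<pi> t) (K t) y = \<pi> t y) \<and>
            \<pi> t summable_on V \<and>
            (\<forall>x\<in>V. \<pi> (t + 1) x \<ge> \<pi> t x))"

text \<open>\<open>law V K x t\<close> is \<open>\<delta>\<^sub>x K\<^sub>1 \<dots> K\<^sub>t\<close>.\<close>

primrec law :: "'a set \<Rightarrow> (nat \<Rightarrow> 'a \<Rightarrow> 'a \<Rightarrow> real) \<Rightarrow> 'a \<Rightarrow> nat \<Rightarrow> 'a \<Rightarrow> real" where
  "law V K x 0 = indicator {x}"
| "law V K x (Suc t) = act V (law V K x t) (K (Suc t))"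

definition s_infinity ::
  "'a set \<Rightarrow> ('a \<Rightarrow> real) \<Rightarrow> ('a \<Rightarrow> real) \<Rightarrow> ('a \<Rightarrow> real) \<Rightarrow> real" where
  "s_infinity V \<mu> \<nu> \<rho> = (MAX z\<in>V. \<bar>(\<mu> z - \<nu> z) / \<rho> z\<bar>)"

end

theory Submission
  imports Defs
begin

text \<open>The factor \<open>1 / \<pi>\<^sub>t(V)\<close> undoes the normalization of \<open>\<pi>\<^sub>t\<close>, so the quantity at time
  \<open>t\<close> is the least \<open>M\<close> with \<open>\<bar>\<mu>\<^sub>t\<^sup>x - \<mu>\<^sub>t\<^sup>y\<bar> \<le> M \<pi>\<^sub>t\<close> pointwise. Applying \<open>K\<^sub>t\<^sub>+\<^sub>1\<close> to this
  inequality, then \<open>\<pi>\<^sub>t \<le> \<pi>\<^sub>t\<^sub>+\<^sub>1\<close> and the invariance of \<open>\<pi>\<^sub>t\<^sub>+\<^sub>1\<close>, gives the same bound at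
  time \<open>t + 1\<close>.\<close>

lemma act_finite: "finite V \<Longrightarrow> act V \<mu> K z = (\<Sum>x\<in>V. \<mu> x * K x z)"
  by (simp add: act_def)

lemma s_infinity_normalized:
  assumes "finite V" "V \<noteq> {}" "mass V \<rho> > 0"
  shows "1 / mass V \<rho> * s_infinity V \<mu> \<nu> (normalized V \<rho>) = s_infinity V \<mu> \<nu> \<rho>"
proof -
  have "mono (\<lambda>r. 1 / mass V \<rho> * r)"
    using assms(3) by (intro monoI mult_left_mono) auto
  then have "1 / mass V \<rho> * s_infinity V \<mu> \<nu> (normalized V \<rho>) =
      Max ((\<lambda>r. 1 / mass V \<rho> * r) ` (\<lambda>z. \<bar>(\<mu> z - \<nu> z) / normalized V \<rho> z\<bar>) ` V)"
    unfolding s_infinity_def using assms(1,2) by (intro mono_Max_commute) auto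
  also have "\<dots> = s_infinity V \<mu> \<nu> \<rho>"
    unfolding s_infinity_def image_image normalized_def
    using assms(3) by (intro arg_cong[of _ _ Max] image_cong refl) (simp add: abs_mult)
  finally show ?thesis .
qed

lemma s_infinity_le_iff:
  assumes "finite V" "V \<noteq> {}" "\<And>z. z \<in> V \<Longrightarrow> \<rho> z > 0"
  shows "s_infinity V \<mu> \<nu> \<rho> \<le> M \<longleftrightarrow> (\<forall>z\<in>V. \<bar>\<mu> z - \<nu> z\<bar> \<le> M * \<rho> z)"
  using assms by (auto simp: s_infinity_def abs_of_pos pos_divide_le_eq)

lemma s_infinity_act_le:
  assumes "finite V" "V \<noteq> {}"
    and K: "\<And>x z. x \<in> V \<Longrightarrow> z \<in> V \<Longrightarrow> K x z \<ge> 0"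
    and pos: "\<And>z. z \<in> V \<Longrightarrow> \<rho> z > 0"
    and le: "\<And>z. z \<in> V \<Longrightarrow> \<rho> z \<le> \<sigma> z"
    and invariant: "\<And>z. z \<in> V \<Longrightarrow> act V \<sigma> K z = \<sigma> z"
  shows "s_infinity V (act V \<mu> K) (act V \<nu> K) \<sigma> \<le> s_infinity V \<mu> \<nu> \<rho>"
proof -
  define M where "M = s_infinity V \<mu> \<nu> \<rho>"
  have bound: "\<bar>\<mu> x - \<nu> x\<bar> \<le> M * \<rho> x" if "x \<in> V" for x
    using s_infinity_le_iff[of V \<rho> \<mu> \<nu> M] assms(1,2) pos that by (simp add: M_def)
  have "M \<ge> 0"
  proof -
    obtain v where "v \<in> V" using \<open>V \<noteq> {}\<close> by blast
    then have "0 \<le> M * \<rho> v" using bound[of v] by linarith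
    then show ?thesis using pos[OF \<open>v \<in> V\<close>] by (simp add: zero_le_mult_iff)
  qed
  have "\<bar>act V \<mu> K z - act V \<nu> K z\<bar> \<le> M * \<sigma> z" if z: "z \<in> V" for z
  proof -
    have "\<bar>act V \<mu> K z - act V \<nu> K z\<bar> = \<bar>\<Sum>x\<in>V. (\<mu> x - \<nu> x) * K x z\<bar>"
      by (simp add: act_finite[OF \<open>finite V\<close>] sum_subtractf left_diff_distrib)
    also have "\<dots> \<le> (\<Sum>x\<in>V. \<bar>\<mu> x - \<nu> x\<bar> * K x z)"
      using K z by (intro order_trans[OF sum_abs] sum_mono) (simp add: abs_mult)
    also have "\<dots> \<le> (\<Sum>x\<in>V. M * \<sigma> x * K x z)"
    proof (intro sum_mono mult_right_mono K z)
      fix x assume x: "x \<in> V"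
      show "\<bar>\<mu> x - \<nu> x\<bar> \<le> M * \<sigma> x"
        using bound[OF x] mult_left_mono[OF le[OF x] \<open>M \<ge> 0\<close>] by linarith
    qed
    also have "\<dots> = M * act V \<sigma> K z"
      by (simp add: act_finite[OF \<open>finite V\<close>] sum_distrib_left mult.assoc)
    finally show ?thesis by (simp add: invariant z)
  qed
  moreover have "\<sigma> z > 0" if "z \<in> V" for z
    using pos[OF that] le[OF that] by linarith
  ultimately show ?thesis
    using assms(1,2) by (simp add: s_infinity_le_iff flip: M_def)
qed

theorem lemma1p15:
  fixes V :: "'a set"
    and K :: "nat \<Rightarrow> 'a \<Rightarrow> 'a \<Rightarrow> real"
    and \<pi> :: "nat \<Rightarrow> 'a \<Rightarrow> real"
  assumes "finite V"
    and "finite_nondecreasing_environment V K \<pi>"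
    and "x \<in> V" and "y \<in> V"
  shows "antimono_on {1..} (\<lambda>t. 1 / mass V (\<pi> t) *
           s_infinity V (law V K x t) (law V K y t) (normalized V (\<pi> t)))"
proof -
  define F where "F t = s_infinity V (law V K x t) (law V K y t) (\<pi> t)" for t
  note env = assms(2)[unfolded finite_nondecreasing_environment_def, rule_format]
  have "V \<noteq> {}" using \<open>x \<in> V\<close> by blast
  have pos: "\<pi> t z > 0" if "t \<ge> 1" "z \<in> V" for t z
    using env[OF that(1)] that(2) by blast
  have mass: "mass V (\<pi> t) > 0" if "t \<ge> 1" for t
    using \<open>finite V\<close> \<open>V \<noteq> {}\<close> pos[OF that] by (simp add: mass_def sum_pos)
  have step: "F (Suc t) \<le> F t" if t: "t \<ge> 1" for t
    unfolding F_def law.simps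
  proof (rule s_infinity_act_le[OF \<open>finite V\<close> \<open>V \<noteq> {}\<close>])
    fix z assume z: "z \<in> V"
    show "K (Suc t) v z \<ge> 0" if "v \<in> V" for v
      using env[of "Suc t"] that z by (simp add: markov_operator_def)
    show "\<pi> t z > 0" by (rule pos[OF t z])
    show "\<pi> t z \<le> \<pi> (Suc t) z" using env[OF t] z by simp
    show "act V (\<pi> (Suc t)) (K (Suc t)) z = \<pi> (Suc t) z" using env[of "Suc t"] z by simp
  qed
  have "F t \<le> F s" if "s \<le> t" "s \<ge> 1" for s t
    using that by (induction t rule: dec_induct) (auto intro: order_trans[OF step])
  then show ?thesis
    using s_infinity_normalized[OF \<open>finite V\<close> \<open>V \<noteq> {}\<close> mass]
    by (intro monotone_onI) (simp add: F_def)
qed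

end
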